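(* Let $1\le r,s,t\le\infty$ with $\frac1r+\frac1s=1+\frac1t$. If $f\in L^r(\mathbb{R})$ and $g\in L^s(\mathbb{R})$, then $f\star_Ag\in L^t(\mathbb{R})$.
   Context: $a,b$ are real numbers with $b\ne0$ (part of the parameter set $A=\{a,b,c,d,p,q\}$ with $ad-bc=1$). The $A$-translation is $T_s^Af(t)=e^{-\frac{2\pi i a}{b}s(t-s)}f(t-s)$ and the $A$-convolution is $(f\star_Ag)(x)=\frac{1}{\sqrt{|b|}}\int_{\mathbb{R}}f(s)\,T_s^Ag(x)\,ds$. *)

theory Defs
  imports "HOL-Analysis.Analysis"
begin

text \<open>The parameter set $A = \{a,b,c,d,p,q\}$ with $ad - bc = 1$. Translation and
  convolution depend only on the entries $a$ and $b$.\<close>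

record A_params =
  A_a :: real
  A_b :: real
  A_c :: real
  A_d :: real
  A_p :: real
  A_q :: real

definition A_admissible :: "A_params \<Rightarrow> bool" where
  "A_admissible A \<longleftrightarrow> A_a A * A_d A - A_b A * A_c A = 1 \<and> A_b A \<noteq> 0"

definition A_translation :: "A_params \<Rightarrow> real \<Rightarrow> (real \<Rightarrow> complex) \<Rightarrow> real \<Rightarrow> complex" where
  "A_translation A s f t =
     exp (- (2 * complex_of_real pi * \<i> * complex_of_real (A_a A) / complex_of_real (A_b A))
            * complex_of_real (s * (t - s))) * f (t - s)"

definition A_conv_integrand ::
    "A_params \<Rightarrow> (real \<Rightarrow> complex) \<Rightarrow> (real \<Rightarrow> complex) \<Rightarrow> real \<Rightarrow> real \<Rightarrow> complex" where
  "A_conv_integrand A f g x s = f s * A_translation A s g x"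

text \<open>The Bochner integral is 0 where the integrand is not integrable, so almost-everywhere
  existence of the convolution is a separate predicate.\<close>

definition A_convolution ::
    "A_params \<Rightarrow> (real \<Rightarrow> complex) \<Rightarrow> (real \<Rightarrow> complex) \<Rightarrow> real \<Rightarrow> complex" where
  "A_convolution A f g x =
     complex_of_real (1 / sqrt \<bar>A_b A\<bar>) * (LINT s|lebesgue. A_conv_integrand A f g x s)"

definition A_convolution_exists ::
    "A_params \<Rightarrow> (real \<Rightarrow> complex) \<Rightarrow> (real \<Rightarrow> complex) \<Rightarrow> bool" where
  "A_convolution_exists A f g \<longleftrightarrow>
     (AE x in lebesgue. integrable lebesgue (A_conv_integrand A f g x))"

text \<open>$L^p(\mathbb{R})$ for $1 \le p \le \infty$, as a set of functions rather than of classes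
  modulo equality almost everywhere.\<close>

definition Lp_space :: "ennreal \<Rightarrow> (real \<Rightarrow> complex) set" where
  "Lp_space p = {f \<in> borel_measurable lebesgue.
     if p = \<infinity> then \<exists>C::real. AE x in lebesgue. norm (f x) \<le> C
     else (\<integral>\<^sup>+ x. ennreal (norm (f x) powr enn2real p) \<partial>lebesgue) < \<infinity>}"

end

(* The chirp in the A-translation has modulus 1, so the A-convolution is dominated pointwise by the
   ordinary convolution of |f| and |g|, and Young's inequality applies. For finite t it suffices to
   bound the t-th power of that convolution at x by a constant multiple of the mixed integral of
   |f(y)|^r |g(x - y)|^s over y, which is integrable in x by Tonelli's theorem. Replacing f and g by
   Borel representatives makes the integrand jointly measurable and changes the convolution nowhere. *)

theory Submission
  imports Defs
begin

section \<open>Pointwise and integrated product bounds\<close>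

text \<open>Each base is at most the total, and the exponents add up to 1. This crude form of
  weighted AM-GM suffices for finiteness.\<close>

lemma weighted_powr_le_sum:
  fixes a b c :: real
  assumes "0 < a" "0 < b" "0 < c" and "0 \<le> \<alpha>" "0 \<le> \<beta>" "0 \<le> \<gamma>" and "\<alpha> + \<beta> + \<gamma> = 1"
  shows "a powr \<alpha> * b powr \<beta> * c powr \<gamma> \<le> a + b + c"
proof -
  let ?M = "a + b + c"
  have "a powr \<alpha> * b powr \<beta> * c powr \<gamma> \<le> ?M powr \<alpha> * ?M powr \<beta> * ?M powr \<gamma>"
    using assms by (intro mult_mono powr_mono2) auto
  also have "\<dots> = ?M powr (\<alpha> + \<beta> + \<gamma>)"
    by (simp add: powr_add)
  also have "\<dots> = ?M"
    using assms by simp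
  finally show ?thesis .
qed

text \<open>The exponent relation splits \<open>u * v\<close> as (u^p v^q)^(1/t) (u^p)^(1/p - 1/t)
  (v^q)^(1/q - 1/t), with outer exponents that sum to 1. Dividing the mixed factor by
  \<open>L powr t\<close> produces exactly 1/L, which leaves a free scale for normalising the mixed
  integral later.\<close>

lemma mult_le_scaled_powr_sum:
  fixes u v L p q t :: real
  assumes pqt: "1 \<le> p" "1 \<le> q" "1 \<le> t" "1 / p + 1 / q = 1 + 1 / t"
    and "0 \<le> u" "0 \<le> v" "0 < L"
  shows "u * v \<le> L * (u powr p * v powr q / L powr t + u powr p + v powr q)"
proof (cases "u = 0 \<or> v = 0")
  case True
  then show ?thesis
    using assms by auto
next
  case False
  then have uv: "0 < u" "0 < v"
    using assms by auto
  define \<beta> \<gamma> where "\<beta> = 1 / p - 1 / t" and "\<gamma> = 1 / q - 1 / t"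
  \<comment> \<open>Nonnegativity of both exponents: 1/p = 1/t + (1 - 1/q), where the bracket is
    nonnegative, and symmetrically for q.\<close>
  have "1 / p \<le> 1" "1 / q \<le> 1"
    using pqt by auto
  with pqt(4) have "1 / t \<le> 1 / p" "1 / t \<le> 1 / q"
    by linarith+
  then have nonneg: "0 \<le> 1 / t" "0 \<le> \<beta>" "0 \<le> \<gamma>" and sum: "1 / t + \<beta> + \<gamma> = 1"
    using pqt by (auto simp: \<beta>_def \<gamma>_def)
  have ex: "p * (1 / t) + p * \<beta> = 1" "q * (1 / t) + q * \<gamma> = 1"
    using pqt by (auto simp: \<beta>_def \<gamma>_def field_simps)
  have "(u powr p * v powr q / L powr t) powr (1 / t) * (u powr p) powr \<beta> * (v powr q) powr \<gamma>
      = (u powr (p * (1 / t)) * u powr (p * \<beta>)) * (v powr (q * (1 / t)) * v powr (q * \<gamma>)) / L"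
    using pqt \<open>0 < L\<close> by (simp add: powr_divide powr_mult powr_powr)
  also have "\<dots> = u * v / L"
    unfolding powr_add[symmetric] ex using uv by simp
  finally have "u * v / L \<le> u powr p * v powr q / L powr t + u powr p + v powr q"
    using weighted_powr_le_sum[of "u powr p * v powr q / L powr t" "u powr p" "v powr q" "1 / t" \<beta> \<gamma>]
      uv \<open>0 < L\<close> nonneg sum by simp
  then show ?thesis
    using \<open>0 < L\<close> by (simp add: field_simps)
qed

text \<open>Only finiteness matters, so instead of the sharp three-function Hoelder inequality we integrate
  the pointwise bound above with the scale \<open>L\<close> chosen so that \<open>L powr t\<close> is the mixed integral.\<close>

lemma nn_integral_mult_le_mixed_powr:
  fixes u v :: "'a \<Rightarrow> real" and p q t h :: real
  assumes pqt: "1 \<le> p" "1 \<le> q" "1 \<le> t" "1 / p + 1 / q = 1 + 1 / t"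
    and [measurable]: "u \<in> borel_measurable M" "v \<in> borel_measurable M"
    and nonneg: "\<And>x. 0 \<le> u x" "\<And>x. 0 \<le> v x" "0 \<le> h"
    and h: "(\<integral>\<^sup>+x. ennreal (u x powr p * v x powr q) \<partial>M) = ennreal h"
  shows "(\<integral>\<^sup>+x. ennreal (u x * v x) \<partial>M) \<le> ennreal (h powr (1 / t)) *
    (1 + (\<integral>\<^sup>+x. ennreal (u x powr p) \<partial>M) + (\<integral>\<^sup>+x. ennreal (v x powr q) \<partial>M))"
\<comment> \<open>Scaling by \<open>1 / h\<close> breaks down at 0, but then the mixed product
  vanishes almost everywhere, and so does \<open>u * v\<close>, since positive reals have positive
  powers.\<close>
proof (cases "h = 0")
  case True
  then have "AE x in M. ennreal (u x powr p * v x powr q) = 0"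
    using h by (intro nn_integral_0_iff_AE[THEN iffD1]) auto
  then have "AE x in M. ennreal (u x * v x) = 0"
    by eventually_elim (use nonneg in \<open>auto simp: ennreal_eq_0_iff mult_le_0_iff powr_gt_zero not_le\<close>)
  then have "(\<integral>\<^sup>+x. ennreal (u x * v x) \<partial>M) = 0"
    by (subst nn_integral_0_iff_AE) auto
  then show ?thesis by simp
next
  case False
  define L where "L = h powr (1 / t)"
  have L: "0 < L" "L powr t = h"
    using False nonneg pqt by (auto simp: L_def powr_powr)
  have "(\<integral>\<^sup>+x. ennreal (u x * v x) \<partial>M)
      \<le> (\<integral>\<^sup>+x. ennreal L * (ennreal (1 / h) * ennreal (u x powr p * v x powr q)
            + ennreal (u x powr p) + ennreal (v x powr q)) \<partial>M)"
  proof (intro nn_integral_mono)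
    fix x
    have "u x * v x \<le> L * (1 / h * (u x powr p * v x powr q) + u x powr p + v x powr q)"
      using mult_le_scaled_powr_sum[OF pqt, of "u x" "v x" L] nonneg L by simp
    then show "ennreal (u x * v x) \<le> ennreal L * (ennreal (1 / h) * ennreal (u x powr p * v x powr q)
            + ennreal (u x powr p) + ennreal (v x powr q))"
      using nonneg L by (simp add: ennreal_mult[symmetric] ennreal_plus[symmetric] ennreal_leI
          del: ennreal_plus)
  qed
  also have "\<dots> = ennreal L * (ennreal (1 / h) * ennreal h
      + (\<integral>\<^sup>+x. ennreal (u x powr p) \<partial>M) + (\<integral>\<^sup>+x. ennreal (v x powr q) \<partial>M))"
    by (simp add: nn_integral_cmult nn_integral_add h)
  also have "ennreal (1 / h) * ennreal h = 1"
    using False nonneg by (simp add: ennreal_mult[symmetric])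
  finally show ?thesis
    by (simp add: L_def)
qed

section \<open>Reflection, translation and Tonelli on the real line\<close>

lemma nn_integral_lborel_reflect:
  fixes \<phi> :: "real \<Rightarrow> ennreal"
  assumes "\<phi> \<in> borel_measurable borel"
  shows "(\<integral>\<^sup>+s. \<phi> (x - s) \<partial>lborel) = (\<integral>\<^sup>+s. \<phi> s \<partial>lborel)"
  using nn_integral_real_affine[OF assms, of "-1" x] by simp

lemma nn_integral_lborel_translate:
  fixes \<phi> :: "real \<Rightarrow> ennreal"
  assumes "\<phi> \<in> borel_measurable borel"
  shows "(\<integral>\<^sup>+s. \<phi> (s - x) \<partial>lborel) = (\<integral>\<^sup>+s. \<phi> s \<partial>lborel)"
  using nn_integral_real_affine[OF assms, of 1 "-x"] by simp

text \<open>The map s -> x - s preserves null sets. As \<open>P\<close> is arbitrary, its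
  exceptional set is first enclosed in a Borel null set \<open>N\<close>, to which affine invariance
  applies.\<close>

lemma AE_lborel_reflect:
  fixes P :: "real \<Rightarrow> bool"
  assumes "AE s in lborel. P s"
  shows "AE s in lborel. P (x - s)"
proof -
  obtain N where N: "\<And>s. s \<in> space lborel - N \<Longrightarrow> P s" "N \<in> null_sets lborel"
    using AE_E3[OF assms] by metis
  then have [measurable]: "N \<in> sets borel"
    by auto
  have "AE s in lborel. s \<notin> N"
    using N by (simp add: AE_not_in)
  then have "AE s in lborel. x + (-1) * s \<notin> N"
    by (intro AE_borel_affine) auto
  then show ?thesis
    by eventually_elim (use N in auto)
qed

text \<open>After Tonelli's swap the inner integral runs over x, and translation invariance removes
  its dependence on s.\<close>

lemma nn_integral_convolution:
  fixes \<phi> \<psi> :: "real \<Rightarrow> ennreal"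
  assumes [measurable]: "\<phi> \<in> borel_measurable borel" "\<psi> \<in> borel_measurable borel"
  shows "(\<integral>\<^sup>+x. (\<integral>\<^sup>+s. \<phi> s * \<psi> (x - s) \<partial>lborel) \<partial>lborel)
    = (\<integral>\<^sup>+s. \<phi> s \<partial>lborel) * (\<integral>\<^sup>+s. \<psi> s \<partial>lborel)"
proof -
  have "(\<integral>\<^sup>+x. (\<integral>\<^sup>+s. \<phi> s * \<psi> (x - s) \<partial>lborel) \<partial>lborel)
      = (\<integral>\<^sup>+s. (\<integral>\<^sup>+x. \<phi> s * \<psi> (x - s) \<partial>lborel) \<partial>lborel)"
    by (intro lborel_pair.Fubini'[symmetric]) measurable
  also have "\<dots> = (\<integral>\<^sup>+s. \<phi> s * (\<integral>\<^sup>+x. \<psi> x \<partial>lborel) \<partial>lborel)"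
    by (simp add: nn_integral_cmult nn_integral_lborel_translate)
  finally show ?thesis
    by (simp add: nn_integral_multc)
qed

section \<open>Young's inequality with real exponents\<close>

text \<open>Where the mixed integral H(x) is finite, \<open>I x\<close> is at most K H(x)^(1/t) with
  K independent of x, so its t-th power is dominated by an integrable function. Finiteness almost
  everywhere is a separate conclusion because \<open>enn2real\<close> sends infinity to 0: the
  second integral alone would not detect infinite values.\<close>

lemma young_convolution_finite_exponent:
  fixes u v :: "real \<Rightarrow> real" and p q t :: real
  assumes pqt: "1 \<le> p" "1 \<le> q" "1 \<le> t" "1 / p + 1 / q = 1 + 1 / t"
    and [measurable]: "u \<in> borel_measurable borel" "v \<in> borel_measurable borel"
    and nonneg: "\<And>x. 0 \<le> u x" "\<And>x. 0 \<le> v x"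
    and fin: "(\<integral>\<^sup>+s. ennreal (u s powr p) \<partial>lborel) < \<infinity>" "(\<integral>\<^sup>+s. ennreal (v s powr q) \<partial>lborel) < \<infinity>"
  defines "I \<equiv> \<lambda>x. \<integral>\<^sup>+s. ennreal (u s * v (x - s)) \<partial>lborel"
  shows "AE x in lborel. I x < \<infinity>"
    and "(\<integral>\<^sup>+x. ennreal (enn2real (I x) powr t) \<partial>lborel) < \<infinity>"
proof -
  define H where "H x = (\<integral>\<^sup>+s. ennreal (u s powr p) * ennreal (v (x - s) powr q) \<partial>lborel)" for x
  \<comment> \<open>The three-term pointwise bound after integration: the normalised mixed term
    contributes 1, the other two the integrals of u^p and v^q.\<close>
  define K where "K = 1 + enn2real (\<integral>\<^sup>+s. ennreal (u s powr p) \<partial>lborel)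
    + enn2real (\<integral>\<^sup>+s. ennreal (v s powr q) \<partial>lborel)"
  have [measurable]: "H \<in> borel_measurable borel"
    unfolding H_def by measurable
  have intH: "(\<integral>\<^sup>+x. H x \<partial>lborel) < \<infinity>"
    unfolding H_def using fin
    by (subst nn_integral_convolution[of "\<lambda>s. ennreal (u s powr p)" "\<lambda>s. ennreal (v s powr q)"])
      (auto simp: ennreal_mult_less_top)
  have finH: "AE x in lborel. H x \<noteq> \<infinity>"
    using intH by (intro nn_integral_noteq_infinite) auto
  have K: "1 + (\<integral>\<^sup>+s. ennreal (u s powr p) \<partial>lborel) + (\<integral>\<^sup>+s. ennreal (v s powr q) \<partial>lborel)
      = ennreal K" "0 \<le> K"
    using fin by (auto simp: K_def ennreal_plus)
  have le: "I x \<le> ennreal (enn2real (H x) powr (1 / t) * K)" if "H x \<noteq> \<infinity>" for x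
  proof -
    have "I x \<le> ennreal (enn2real (H x) powr (1 / t)) *
      (1 + (\<integral>\<^sup>+s. ennreal (u s powr p) \<partial>lborel) + (\<integral>\<^sup>+s. ennreal (v (x - s) powr q) \<partial>lborel))"
      unfolding I_def using that nonneg
      by (intro nn_integral_mult_le_mixed_powr[OF pqt]) (auto simp: H_def ennreal_mult less_top)
    \<comment> \<open>Reflection invariance frees the last term of x, so a single \<open>K\<close>
      serves every x.\<close>
    also have "(\<integral>\<^sup>+s. ennreal (v (x - s) powr q) \<partial>lborel) = (\<integral>\<^sup>+s. ennreal (v s powr q) \<partial>lborel)"
      by (rule nn_integral_lborel_reflect) measurable
    finally show ?thesis
      using K by (simp add: ennreal_mult)
  qed
  show "AE x in lborel. I x < \<infinity>"
    using finH by eventually_elim (use le in \<open>auto intro: le_less_trans[OF _ ennreal_less_top]\<close>)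
  have "(\<integral>\<^sup>+x. ennreal (enn2real (I x) powr t) \<partial>lborel) \<le> (\<integral>\<^sup>+x. ennreal (K powr t) * H x \<partial>lborel)"
  proof (rule nn_integral_mono_AE)
    show "AE x in lborel. ennreal (enn2real (I x) powr t) \<le> ennreal (K powr t) * H x"
      using finH
    proof eventually_elim
      case (elim x)
      have "enn2real (I x) \<le> enn2real (H x) powr (1 / t) * K"
        using le[OF elim] K by (intro enn2real_leI) auto
      then have "enn2real (I x) powr t \<le> (enn2real (H x) powr (1 / t) * K) powr t"
        using pqt by (intro powr_mono2) auto
      also have "\<dots> = K powr t * enn2real (H x)"
        using pqt by (simp add: powr_mult powr_powr)
      finally have "ennreal (enn2real (I x) powr t) \<le> ennreal (K powr t) * ennreal (enn2real (H x))"
        by (simp add: ennreal_mult[symmetric] ennreal_leI)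
      then show ?case
        using elim by (simp add: less_top)
    qed
  qed
  also have "\<dots> = ennreal (K powr t) * (\<integral>\<^sup>+x. H x \<partial>lborel)"
    by (simp add: nn_integral_cmult)
  also have "\<dots> < \<infinity>"
    using intH by (simp add: ennreal_mult_less_top)
  finally show "(\<integral>\<^sup>+x. ennreal (enn2real (I x) powr t) \<partial>lborel) < \<infinity>" .
qed


section \<open>Endpoint bound, Borel representatives and exponent cases\<close>

text \<open>Hoelder's inequality for the exponent pair (infinity, 1), which serves the endpoint
  cases of an infinite target exponent.\<close>

lemma nn_integral_norm_mult_le:
  assumes "AE s in lborel. norm (F s :: 'b::real_normed_vector) \<le> C"
    and [measurable]: "v \<in> borel_measurable lborel"
  shows "(\<integral>\<^sup>+s. ennreal (norm (F s) * norm (v s)) \<partial>lborel)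
    \<le> ennreal C * (\<integral>\<^sup>+s. ennreal (norm (v s)) \<partial>lborel)"
proof -
  have "(\<integral>\<^sup>+s. ennreal (norm (F s) * norm (v s)) \<partial>lborel)
      \<le> (\<integral>\<^sup>+s. ennreal C * ennreal (norm (v s)) \<partial>lborel)"
    using assms(1)
    by (intro nn_integral_mono_AE, eventually_elim) (auto simp: ennreal_mult intro!: mult_right_mono ennreal_leI)
  then show ?thesis
    by (simp add: nn_integral_cmult)
qed

text \<open>A Borel function composed with (x, y) -> x - y is measurable on the Borel product, as
  Tonelli requires; Lebesgue measurability alone does not give this. Real and imaginary parts are
  replaced separately, and membership survives because both clauses of \<open>Lp_space\<close>
  ignore null sets.\<close>

lemma Lp_space_borel_representative:
  assumes "f \<in> Lp_space p"
  obtains F where "F \<in> borel_measurable borel" "AE x in lborel. f x = F x" "F \<in> Lp_space p"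
proof -
  have f[measurable]: "f \<in> borel_measurable lebesgue"
    using assms by (simp add: Lp_space_def)
  have "(\<lambda>x. Re (f x)) \<in> borel_measurable lebesgue" "(\<lambda>x. Im (f x)) \<in> borel_measurable lebesgue"
    by measurable
  then obtain F1 F2 where [measurable]: "F1 \<in> borel_measurable borel" "F2 \<in> borel_measurable borel"
    and F: "AE x in lborel. Re (f x) = F1 x" "AE x in lborel. Im (f x) = F2 x"
    using completion_ex_borel_measurable_real[of _ lborel] by (metis measurable_lborel2)
  define F where "F x = complex_of_real (F1 x) + \<i> * complex_of_real (F2 x)" for x
  have meas[measurable]: "F \<in> borel_measurable borel"
    unfolding F_def by measurable
  have ae: "AE x in lborel. f x = F x"
    using F by eventually_elim (simp add: F_def complex_eq_iff)
  have "F \<in> Lp_space p"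
  proof (cases "p = \<infinity>")
    case True
    then obtain C where "AE x in lebesgue. norm (f x) \<le> C"
      using assms by (auto simp: Lp_space_def)
    then have "AE x in lebesgue. norm (F x) \<le> C"
      using AE_completion[OF ae] by eventually_elim simp
    then show ?thesis
      using True meas by (auto simp: Lp_space_def intro: measurable_completion)
  next
    case False
    have "(\<integral>\<^sup>+ x. ennreal (norm (f x) powr enn2real p) \<partial>lebesgue)
        = (\<integral>\<^sup>+ x. ennreal (norm (F x) powr enn2real p) \<partial>lebesgue)"
      using AE_completion[OF ae] by (intro nn_integral_cong_AE, eventually_elim) simp
    then show ?thesis
      using False assms meas by (auto simp: Lp_space_def intro: measurable_completion)
  qed
  with that meas ae show ?thesis
    by blast
qed

text \<open>Carrying the reciprocal along in the finite case lets relations between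
  \<open>ennreal\<close> exponents be transferred to real arithmetic.\<close>

lemma ennreal_exponent_cases:
  assumes "1 \<le> (p::ennreal)"
  obtains "p = \<infinity>" | P where "1 \<le> P" "p = ennreal P" "1 / p = ennreal (1 / P)"
proof (cases p)
  case (real P)
  then have "1 \<le> P"
    using assms by (simp add: ennreal_1[symmetric] del: ennreal_1)
  moreover from this have "1 / p = ennreal (1 / P)"
    using real divide_ennreal[of 1 P] by simp
  ultimately show ?thesis
    using that real by blast
qed (use that in auto)

section \<open>Young's inequality with extended exponents\<close>

text \<open>For infinite t the exponents r and s are conjugate, and Hoelder-type estimates give a
  bound at every x. For finite t both r and s turn out finite, and the version with real exponents
  applies.\<close>

lemma young_convolution_Lp:
  fixes r s t :: ennreal and F G :: "real \<Rightarrow> complex"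
  assumes rst: "1 \<le> r" "1 \<le> s" "1 \<le> t" "1 / r + 1 / s = 1 + 1 / t"
    and F: "F \<in> Lp_space r" and G: "G \<in> Lp_space s"
    and [measurable]: "F \<in> borel_measurable borel" "G \<in> borel_measurable borel"
  defines "I \<equiv> \<lambda>x. \<integral>\<^sup>+y. ennreal (norm (F y) * norm (G (x - y))) \<partial>lborel"
  shows "AE x in lborel. I x < \<infinity>"
    and "if t = \<infinity> then \<exists>C. \<forall>x. I x \<le> ennreal C
      else (\<integral>\<^sup>+x. ennreal (enn2real (I x) powr enn2real t) \<partial>lborel) < \<infinity>"
proof -
  have Linf: "\<exists>C. AE x in lborel. norm (h x) \<le> C" if "h \<in> Lp_space \<infinity>" for h
    using that by (auto simp: Lp_space_def AE_completion_iff)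
  have Lfin: "(\<integral>\<^sup>+x. ennreal (norm (h x) powr P) \<partial>lborel) < \<infinity>"
    if "h \<in> Lp_space (ennreal P)" "1 \<le> P" for h P
    using that by (auto simp: Lp_space_def nn_integral_completion)
  have reflect: "(\<integral>\<^sup>+y. ennreal (norm (G (x - y)) powr P) \<partial>lborel)
      = (\<integral>\<^sup>+y. ennreal (norm (G y) powr P) \<partial>lborel)" for x P
    by (rule nn_integral_lborel_reflect) measurable
  have reflect1: "(\<integral>\<^sup>+y. ennreal (norm (G (x - y))) \<partial>lborel)
      = (\<integral>\<^sup>+y. ennreal (norm (G y)) \<partial>lborel)" for x
    by (rule nn_integral_lborel_reflect) measurable
  have bounded: "\<exists>C. \<forall>x. I x \<le> ennreal C" if t: "t = \<infinity>"
  proof -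
    have sum: "1 / r + 1 / s = 1"
      using rst t by simp
    have "\<exists>K<\<infinity>. \<forall>x. I x \<le> K"
    \<comment> \<open>Conjugacy leaves three cases: infinite r with s = 1, infinite s with r = 1, or
      both finite and greater than 1.\<close>
    proof (cases rule: ennreal_exponent_cases[OF rst(1)])
      case r: 1
      then have "s = 1"
        using sum rst by (cases rule: ennreal_exponent_cases[OF rst(2)])
          (auto simp: ennreal_eq_1 divide_eq_1_iff)
      with G have "(\<integral>\<^sup>+y. ennreal (norm (G y)) \<partial>lborel) < \<infinity>"
        using Lfin[of G 1] by simp
      moreover obtain C where C: "AE x in lborel. norm (F x) \<le> C"
        using Linf F r by auto
      have "I x \<le> ennreal C * (\<integral>\<^sup>+y. ennreal (norm (G y)) \<partial>lborel)" for x
        unfolding I_def reflect1[of x, symmetric] by (rule nn_integral_norm_mult_le[OF C]) measurable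
      ultimately show ?thesis
        by (intro exI[of _ "ennreal C * (\<integral>\<^sup>+y. ennreal (norm (G y)) \<partial>lborel)"])
          (auto simp: ennreal_mult_less_top)
    next
      case r: (2 R)
      show ?thesis
      proof (cases rule: ennreal_exponent_cases[OF rst(2)])
        case s: 1
        then have "r = 1"
          using sum r by (auto simp: ennreal_eq_1 divide_eq_1_iff)
        with F have "(\<integral>\<^sup>+y. ennreal (norm (F y)) \<partial>lborel) < \<infinity>"
          using Lfin[of F 1] by simp
        moreover obtain C where C: "AE x in lborel. norm (G x) \<le> C"
          using Linf G s by auto
        have "I x \<le> ennreal C * (\<integral>\<^sup>+y. ennreal (norm (F y)) \<partial>lborel)" for x
          \<comment> \<open>The factors swap roles here: reflection transfers the essential bound of
            \<open>G\<close> to y -> G(x - y), for every x.\<close>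
          unfolding I_def mult.commute[of "norm (F _)"]
          by (rule nn_integral_norm_mult_le[OF AE_lborel_reflect[OF C]]) measurable
        ultimately show ?thesis
          by (intro exI[of _ "ennreal C * (\<integral>\<^sup>+y. ennreal (norm (F y)) \<partial>lborel)"])
            (auto simp: ennreal_mult_less_top)
      next
        case s: (2 S)
        have RS: "1 / R + 1 / S = 1"
          using sum r s by (simp add: ennreal_plus[symmetric] ennreal_eq_1 del: ennreal_plus)
        then have "1 < R" "1 < S"
          using r s by (auto simp: field_simps intro: ccontr)
        \<comment> \<open>Young's inequality for products with the weights 1/R and 1/S enlarged to
          1: only a bound uniform in x is wanted, not the Hoelder constant.\<close>
        then have pw: "a * b \<le> a powr R + b powr S" if "0 \<le> a" "0 \<le> b" for a b
          using Youngs_inequality[OF _ _ RS that] frac_le[of "a powr R" "a powr R" 1 R]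
            frac_le[of "b powr S" "b powr S" 1 S] by simp
        let ?K = "(\<integral>\<^sup>+y. ennreal (norm (F y) powr R) \<partial>lborel) + (\<integral>\<^sup>+y. ennreal (norm (G y) powr S) \<partial>lborel)"
        have "I x \<le> ?K" for x
        proof -
          have "I x \<le> (\<integral>\<^sup>+y. ennreal (norm (F y) powr R) + ennreal (norm (G (x - y)) powr S) \<partial>lborel)"
            unfolding I_def
            by (intro nn_integral_mono) (simp add: pw ennreal_plus[symmetric] ennreal_leI del: ennreal_plus)
          also have "\<dots> = ?K"
            by (simp add: nn_integral_add reflect)
          finally show ?thesis .
        qed
        moreover have "?K < \<infinity>"
          using Lfin F G r s by auto
        ultimately show ?thesis by blast
      qed
    qed
    then obtain K where "K < \<infinity>" "\<forall>x. I x \<le> K"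
      by blast
    then show ?thesis
      by (intro exI[of _ "enn2real K"]) simp
  qed
  have finite: "(AE x in lborel. I x < \<infinity>) \<and> (\<integral>\<^sup>+x. ennreal (enn2real (I x) powr enn2real t) \<partial>lborel) < \<infinity>"
    if t: "t \<noteq> \<infinity>"
  proof -
    obtain T where T: "1 \<le> T" "t = ennreal T" "1 / t = ennreal (1 / T)"
      using rst(3) t by (cases rule: ennreal_exponent_cases) auto
    \<comment> \<open>An infinite r or s would have reciprocal 0 and leave a sum of at most 1, so
      the strict inequality forces both to be finite.\<close>
    have gt: "1 < 1 / r + 1 / s"
      using T rst(4) by (simp add: ennreal_1[symmetric] ennreal_plus[symmetric] ennreal_less_iff
          del: ennreal_1 ennreal_plus)
    have "1 / p \<le> 1" if "1 \<le> p" for p :: ennreal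
      using that by (cases rule: ennreal_exponent_cases) (auto simp: ennreal_le_1)
    then have le1: "1 / r \<le> 1" "1 / s \<le> 1"
      using rst by auto
    obtain R where R: "1 \<le> R" "r = ennreal R" "1 / r = ennreal (1 / R)"
      using rst(1) gt le1 by (cases rule: ennreal_exponent_cases) auto
    obtain S where S: "1 \<le> S" "s = ennreal S" "1 / s = ennreal (1 / S)"
      using rst(2) gt le1 by (cases rule: ennreal_exponent_cases) auto
    have "1 / R + 1 / S = 1 + 1 / T"
      using rst(4) R S T unfolding R S T
      by (simp add: ennreal_1[symmetric] ennreal_plus[symmetric] del: ennreal_1 ennreal_plus)
    note young = young_convolution_finite_exponent[OF R(1) S(1) T(1) this,
        of "\<lambda>x. norm (F x)" "\<lambda>x. norm (G x)", folded I_def]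
    have "(\<integral>\<^sup>+x. ennreal (norm (F x) powr R) \<partial>lborel) < \<infinity>"
      "(\<integral>\<^sup>+x. ennreal (norm (G x) powr S) \<partial>lborel) < \<infinity>"
      using Lfin F G R S by auto
    then show ?thesis
      using young T by (auto simp: I_def)
  qed
  show "AE x in lborel. I x < \<infinity>"
    using bounded finite by (cases "t = \<infinity>") (auto intro: le_less_trans[OF _ ennreal_less_top])
  show "if t = \<infinity> then \<exists>C. \<forall>x. I x \<le> ennreal C
      else (\<integral>\<^sup>+x. ennreal (enn2real (I x) powr enn2real t) \<partial>lborel) < \<infinity>"
    using bounded finite by simp
qed

section \<open>The A-convolution\<close>

text \<open>Grouping the real factors exhibits the exponent of the chirp as i times a real
  number.\<close>

lemma norm_A_conv_integrand:
  "norm (A_conv_integrand A f g x s) = norm (f s) * norm (g (x - s))"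
proof -
  have "- (2 * complex_of_real pi * \<i> * complex_of_real (A_a A) / complex_of_real (A_b A))
      * complex_of_real (s * (x - s)) = \<i> * complex_of_real (- (2 * pi * A_a A / A_b A * (s * (x - s))))"
    by simp
  then show ?thesis
    unfolding A_conv_integrand_def A_translation_def norm_mult by (simp only: norm_exp_i_times mult_1)
qed

lemma borel_measurable_A_conv_integrand:
  assumes [measurable]: "F \<in> borel_measurable borel" "G \<in> borel_measurable borel"
  shows "(\<lambda>(x, s). A_conv_integrand A F G x s) \<in> borel_measurable (borel \<Otimes>\<^sub>M borel)"
  unfolding A_conv_integrand_def A_translation_def by measurable

text \<open>The null set where \<open>g\<close> and \<open>G\<close> differ stays null under s -> x
  - s for every x, not only for almost every x. Hence a change of representatives leaves the
  convolution unchanged at each point.\<close>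

lemma A_conv_integrand_cong_AE:
  assumes "AE x in lborel. f x = F x" "AE x in lborel. g x = G x"
  shows "AE s in lebesgue. A_conv_integrand A F G x s = A_conv_integrand A f g x s"
  by (rule AE_completion, use assms(1) AE_lborel_reflect[OF assms(2), of x] in eventually_elim)
    (simp add: A_conv_integrand_def A_translation_def)

theorem theorem3p11:
  fixes A :: A_params
    and r s t :: ennreal
    and f g :: "real \<Rightarrow> complex"
  assumes "A_admissible A"
    and "1 \<le> r" and "1 \<le> s" and "1 \<le> t"
    and "1 / r + 1 / s = 1 + 1 / t"
    and "f \<in> Lp_space r" and "g \<in> Lp_space s"
  shows "A_convolution_exists A f g \<and> A_convolution A f g \<in> Lp_space t"
proof -
  obtain F where F[measurable]: "F \<in> borel_measurable borel"
    and fF: "AE x in lborel. f x = F x" and FL: "F \<in> Lp_space r"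
    using Lp_space_borel_representative[OF \<open>f \<in> Lp_space r\<close>] by metis
  obtain G where G[measurable]: "G \<in> borel_measurable borel"
    and gG: "AE x in lborel. g x = G x" and GL: "G \<in> Lp_space s"
    using Lp_space_borel_representative[OF \<open>g \<in> Lp_space s\<close>] by metis
  define I where "I x = (\<integral>\<^sup>+y. ennreal (norm (F y) * norm (G (x - y))) \<partial>lborel)" for x
  define J where "J = A_conv_integrand A F G"
  have joint[measurable]: "case_prod J \<in> borel_measurable (borel \<Otimes>\<^sub>M borel)"
    unfolding J_def using borel_measurable_A_conv_integrand[OF F G] by simp
  have J[measurable]: "J x \<in> borel_measurable borel" for x
    using measurable_compose[OF measurable_Pair1' joint, of x] by simp
  have J_eq: "AE y in lebesgue. J x y = A_conv_integrand A f g x y" for x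
    unfolding J_def by (rule A_conv_integrand_cong_AE[OF fF gG])
  have J_leb: "J x \<in> borel_measurable lebesgue" for x
    using J by (intro measurable_completion) simp
  have fg_leb: "A_conv_integrand A f g x \<in> borel_measurable lebesgue" for x
    using borel_measurable_AE[OF J_leb J_eq] .
  have integrable_iff: "integrable lebesgue (A_conv_integrand A f g x) \<longleftrightarrow> integrable lborel (J x)" for x
    using integrable_cong_AE[OF J_leb fg_leb J_eq] J by (simp add: integrable_completion)
  \<comment> \<open>Valid at every x: if one integrand fails to be integrable, so does the other,
    and both Bochner integrals are 0.\<close>
  have conv_eq: "A_convolution A f g x = complex_of_real (1 / sqrt \<bar>A_b A\<bar>) * (LINT y|lborel. J x y)" for x
    unfolding A_convolution_def using integral_cong_AE[OF J_leb fg_leb J_eq] J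
    by (simp add: integral_completion)
  \<comment> \<open>Hence \<open>I x < \<infinity>\<close> says exactly that \<open>J x\<close> is
    integrable.\<close>
  have I_J: "I x = (\<integral>\<^sup>+y. ennreal (norm (J x y)) \<partial>lborel)" for x
    by (simp add: I_def J_def norm_A_conv_integrand)
  note young = young_convolution_Lp[OF assms(2-5) FL GL F G, folded I_def]
  have exists: "A_convolution_exists A f g"
    unfolding A_convolution_exists_def integrable_iff
    by (rule AE_completion, use young(1) in eventually_elim) (auto simp: I_J integrable_iff_bounded)
  \<comment> \<open>Joint measurability of \<open>J\<close> makes its parametrised integral Borel in
    x, and \<open>conv_eq\<close> carries this over to the original \<open>f\<close> and
    \<open>g\<close>.\<close>
  have "(\<lambda>x. complex_of_real (1 / sqrt \<bar>A_b A\<bar>) * (LINT y|lborel. J x y)) \<in> borel_measurable lborel"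
    by measurable
  then have meas: "A_convolution A f g \<in> borel_measurable lebesgue"
    unfolding conv_eq[abs_def] by (rule measurable_completion)
  define c where "c = 1 / sqrt \<bar>A_b A\<bar>"
  have c: "0 \<le> c"
    by (simp add: c_def)
  have le: "norm (A_convolution A f g x) \<le> c * enn2real (I x)" if "I x < \<infinity>" for x
  proof -
    have "ennreal (norm (LINT y|lborel. J x y)) \<le> I x"
      using that unfolding I_J by (intro integral_norm_bound_ennreal) (simp add: integrable_iff_bounded)
    then have "norm (LINT y|lborel. J x y) \<le> enn2real (I x)"
      using that by (metis enn2real_ennreal enn2real_mono infinity_ennreal_def norm_ge_zero)
    then show ?thesis
      using c unfolding conv_eq c_def[symmetric] norm_mult by (simp add: mult_left_mono)
  qed
  have "A_convolution A f g \<in> Lp_space t"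
  proof (cases "t = \<infinity>")
    case True
    then obtain C where C: "\<And>x. I x \<le> ennreal C"
      using young(2) by auto
    \<comment> \<open>\<open>enn2real (ennreal C)\<close> is \<open>C\<close> cut off below at 0, so
      the bound makes sense whatever the sign of \<open>C\<close>.\<close>
    have "norm (A_convolution A f g x) \<le> c * enn2real (ennreal C)" for x
    proof -
      have "norm (A_convolution A f g x) \<le> c * enn2real (I x)"
        using C[of x] by (intro le) (auto intro: le_less_trans[OF _ ennreal_less_top])
      also have "\<dots> \<le> c * enn2real (ennreal C)"
        using C c by (intro mult_left_mono enn2real_mono) auto
      finally show ?thesis .
    qed
    then show ?thesis
      using True meas by (auto simp: Lp_space_def)
  next
    case False
    let ?T = "enn2real t"
    have [measurable]: "I \<in> borel_measurable borel"
      unfolding I_def by measurable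
    have "(\<integral>\<^sup>+x. ennreal (norm (A_convolution A f g x) powr ?T) \<partial>lebesgue)
        \<le> (\<integral>\<^sup>+x. ennreal (c powr ?T) * ennreal (enn2real (I x) powr ?T) \<partial>lborel)"
      unfolding nn_integral_completion
    \<comment> \<open>The null set where \<open>I\<close> is infinite is discarded; elsewhere the
      pointwise bound is raised to the t-th power.\<close>
    proof (rule nn_integral_mono_AE, use young(1) in eventually_elim)
      case (elim x)
      have "norm (A_convolution A f g x) powr ?T \<le> (c * enn2real (I x)) powr ?T"
        using le[OF elim] by (intro powr_mono2) auto
      then show ?case
        by (simp add: powr_mult ennreal_mult[symmetric] ennreal_leI)
    qed
    also have "\<dots> < \<infinity>"
      using False young(2) by (simp add: nn_integral_cmult ennreal_mult_less_top)
    finally show ?thesis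
      using False meas by (simp add: Lp_space_def)
  qed
  with exists show ?thesis ..
qed

end
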